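(* Let $k\in\mathbb{N}$. The equation $$x^2+y^2+z^2+2yz=kxyz$$ has a positive integer solution if and only if $1\le k\le 5$. More precisely: (1) For $k=1$, its positive integer solutions form four generalized cluster mutation orbits: $\widehat{\Gamma}[(9,3,6)]$, $\widehat{\Gamma}[(9,6,3)]$, $\widehat{\Gamma}[(8,4,4)]$, $\widehat{\Gamma}[(5,5,5)]$. (2) For $k=3$, its positive integer solutions form two generalized cluster mutation orbits: $\widehat{\Gamma}[(3,2,1)]$, $\widehat{\Gamma}[(3,1,2)]$. (3) For $k=2,4,5$, the positive integer solution set is the single orbit $\widehat{\Gamma}[(4,2,2)]$, $\widehat{\Gamma}[(2,1,1)]$, $\widehat{\Gamma}[(1,1,1)]$, respectively.
   Context: $\mathbb{N}$ denotes the non-negative integers. $\widehat{\Gamma}=\langle\widehat{\mu}_1,\widehat{\mu}_2,\widehat{\mu}_3\rangle$ is the group of transformations of $\mathbb{Q}_+^3$ (triples of positive rationals) generated by the involutions $$\widehat{\mu}_1(x,y,z)=\left(\frac{(y+z)^2}{x},y,z\right),\quad \widehat{\mu}_2(x,y,z)=\left(x,\frac{x^2+z^2}{y},z\right),\quad \widehat{\mu}_3(x,y,z)=\left(x,y,\frac{x^2+y^2}{z}\right),$$ and $\widehat{\Gamma}[p]$ denotes the $\widehat{\Gamma}$-orbit of a point $p$. *)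

theory Defs
  imports "HOL-Algebra.Algebra" "HOL-Library.Disjoint_Sets"
begin

definition Qpos3 :: "(rat \<times> rat \<times> rat) set" where
  "Qpos3 = {(x, y, z). 0 < x \<and> 0 < y \<and> 0 < z}"

text \<open>
  The generators are restricted to \<open>Qpos3\<close> because the elements of \<^term>\<open>BijGroup S\<close> are
  extensional, i.e. fixed to \<^term>\<open>undefined\<close> outside \<open>S\<close>.
\<close>

definition mu1 :: "rat \<times> rat \<times> rat \<Rightarrow> rat \<times> rat \<times> rat" where
  "mu1 = (\<lambda>(x, y, z)\<in>Qpos3. ((y + z)^2 / x, y, z))"

definition mu2 :: "rat \<times> rat \<times> rat \<Rightarrow> rat \<times> rat \<times> rat" where
  "mu2 = (\<lambda>(x, y, z)\<in>Qpos3. (x, (x^2 + z^2) / y, z))"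

definition mu3 :: "rat \<times> rat \<times> rat \<Rightarrow> rat \<times> rat \<times> rat" where
  "mu3 = (\<lambda>(x, y, z)\<in>Qpos3. (x, y, (x^2 + y^2) / z))"

definition Gamma_hat :: "(rat \<times> rat \<times> rat \<Rightarrow> rat \<times> rat \<times> rat) monoid" where
  "Gamma_hat = subgroup_generated (BijGroup Qpos3) {mu1, mu2, mu3}"

definition Gamma_orbit :: "rat \<times> rat \<times> rat \<Rightarrow> (rat \<times> rat \<times> rat) set" where
  "Gamma_orbit p = orbit Gamma_hat (\<lambda>g. g) p"

definition is_pos_int_sol :: "nat \<Rightarrow> int \<Rightarrow> int \<Rightarrow> int \<Rightarrow> bool" where
  "is_pos_int_sol k x y z \<longleftrightarrow>
     0 < x \<and> 0 < y \<and> 0 < z \<and> x^2 + y^2 + z^2 + 2 * y * z = int k * x * y * z"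

definition pos_int_sols :: "nat \<Rightarrow> (rat \<times> rat \<times> rat) set" where
  "pos_int_sols k = {(of_int x, of_int y, of_int z) | x y z. is_pos_int_sol k x y z}"

text \<open>
  \<^const>\<open>subgroup_generated\<close> discards generators outside the carrier of the ambient group;
  the following lemma shows that none is lost.
\<close>

lemma involution_imp_Bij:
  assumes "f \<in> extensional S" and "\<And>x. x \<in> S \<Longrightarrow> f x \<in> S" and "\<And>x. x \<in> S \<Longrightarrow> f (f x) = x"
  shows "f \<in> Bij S"
  using assms unfolding Bij_def by (auto intro: bij_betw_byWitness[where f' = f])

lemma mu_in_carrier: "{mu1, mu2, mu3} \<subseteq> carrier (BijGroup Qpos3)"
proof -
  have "mu1 \<in> Bij Qpos3"
    by (rule involution_imp_Bij)
       (auto simp: mu1_def Qpos3_def add_pos_pos power2_eq_square)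
  moreover have "mu2 \<in> Bij Qpos3"
    by (rule involution_imp_Bij)
       (auto simp: mu2_def Qpos3_def sum_power2_gt_zero_iff)
  moreover have "mu3 \<in> Bij Qpos3"
    by (rule involution_imp_Bij)
       (auto simp: mu3_def Qpos3_def sum_power2_gt_zero_iff)
  ultimately show ?thesis
    by (simp add: BijGroup_def)
qed

end

theory Submission
  imports Defs
begin

text \<open>
  On solutions the three generators are the Vieta involutions of the equation read as a quadratic
  in one variable, so they act on positive integer solutions, and descent on \<open>x + y + z\<close> brings
  every solution to one with \<open>x \<le> y + z\<close>, \<open>y\<^sup>2 \<le> x\<^sup>2 + z\<^sup>2\<close> and \<open>z\<^sup>2 \<le> x\<^sup>2 + y\<^sup>2\<close>.
  In such a reduced solution every variable is the smaller root of its quadratic; evaluating the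
  quadratic of the largest variable at the second largest one bounds \<open>k\<close> times the smallest
  variable by \<open>5\<close>, which leaves finitely many candidates. The remaining representatives are
  separated by the invariant \<open>gcd x (gcd y z)\<close> and, for the pairs exchanged by swapping \<open>y\<close> and
  \<open>z\<close>, by the residue of \<open>y\<close> modulo \<open>9\<close> (for \<open>k = 1\<close>) or \<open>3\<close> (for \<open>k = 3\<close>).
\<close>

section \<open>The mutation group and its orbits\<close>

lemma mu_mem_Qpos3:
  assumes "m \<in> {mu1, mu2, mu3}" "p \<in> Qpos3"
  shows "m p \<in> Qpos3"
  using assms by (auto simp: mu1_def mu2_def mu3_def Qpos3_def add_pos_pos sum_power2_gt_zero_iff)

lemma mu_involution:
  assumes "m \<in> {mu1, mu2, mu3}" "p \<in> Qpos3"
  shows "m (m p) = p"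
  using assms
  by (auto simp: mu1_def mu2_def mu3_def Qpos3_def add_pos_pos sum_power2_gt_zero_iff power2_eq_square)

text \<open>Lets inverses of generators be treated as generators in inductions over
  \<open>generate\<close>.\<close>

lemma inv_mu:
  assumes "m \<in> {mu1, mu2, mu3}"
  shows "inv\<^bsub>BijGroup Qpos3\<^esub> m = m"
proof -
  have B: "m \<in> Bij Qpos3"
    using assms mu_in_carrier by (auto simp: BijGroup_def)
  have "compose Qpos3 m m = (\<lambda>p\<in>Qpos3. p)"
    using mu_involution[OF assms] by (auto simp: compose_def restrict_def)
  with B show ?thesis
    by (intro group.inv_equality[OF group_BijGroup]) (simp_all add: BijGroup_def)
qed

lemma carrier_Gamma_hat: "carrier Gamma_hat = generate (BijGroup Qpos3) {mu1, mu2, mu3}"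
  using mu_in_carrier
  by (simp add: Gamma_hat_def carrier_subgroup_generated Int_absorb1 del: insert_subset)

lemma Gamma_hat_subset_Bij: "carrier Gamma_hat \<subseteq> Bij Qpos3"
  using group.generate_incl[OF group_BijGroup mu_in_carrier]
  by (simp add: carrier_Gamma_hat BijGroup_def)

lemma mem_Gamma_orbit_self:
  assumes "p \<in> Qpos3"
  shows "p \<in> Gamma_orbit p"
proof -
  have "\<one>\<^bsub>BijGroup Qpos3\<^esub> \<in> carrier Gamma_hat"
    unfolding carrier_Gamma_hat by (rule generate.one)
  moreover have "\<one>\<^bsub>BijGroup Qpos3\<^esub> p = p"
    using assms by (simp add: BijGroup_def)
  ultimately show ?thesis
    unfolding Gamma_orbit_def orbit_def mem_Collect_eq by metis
qed

lemma mu_mem_Gamma_orbit: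
  assumes m: "m \<in> {mu1, mu2, mu3}" and p: "p \<in> Qpos3" and q: "q \<in> Gamma_orbit p"
  shows "m q \<in> Gamma_orbit p"
proof -
  obtain g where g: "g \<in> carrier Gamma_hat" "q = g p"
    using q by (auto simp: Gamma_orbit_def orbit_def)
  have "m \<otimes>\<^bsub>BijGroup Qpos3\<^esub> g \<in> carrier Gamma_hat"
    using generate.eng[OF generate.incl[OF m]] g(1) unfolding carrier_Gamma_hat by blast
  moreover have "(m \<otimes>\<^bsub>BijGroup Qpos3\<^esub> g) p = m q"
  proof -
    have "m \<in> Bij Qpos3" "g \<in> Bij Qpos3"
      using m g(1) mu_in_carrier Gamma_hat_subset_Bij by (auto simp: BijGroup_def)
    then show ?thesis
      using g(2) p by (simp add: BijGroup_def compose_def)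
  qed
  ultimately show ?thesis
    unfolding Gamma_orbit_def orbit_def mem_Collect_eq by metis
qed

text \<open>Pulls orbit membership back along a mutation, the direction in which descent needs
  it.\<close>

lemma mem_Gamma_orbit_if_mu_mem:
  assumes "m \<in> {mu1, mu2, mu3}" "p \<in> Qpos3" "q \<in> Qpos3" "m q \<in> Gamma_orbit p"
  shows "q \<in> Gamma_orbit p"
  using mu_mem_Gamma_orbit[OF assms(1,2,4)] mu_involution[OF assms(1,3)] by simp

text \<open>Closure under the three generators suffices because each is its own inverse.
  \<open>S\<close> lies inside \<open>Qpos3\<close> because the operations of
  \<open>BijGroup Qpos3\<close> agree with composition and identity only there.\<close>

lemma Gamma_orbit_subset:
  assumes S: "S \<subseteq> Qpos3" and closed: "\<And>m q. m \<in> {mu1, mu2, mu3} \<Longrightarrow> q \<in> S \<Longrightarrow> m q \<in> S"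
    and p: "p \<in> S"
  shows "Gamma_orbit p \<subseteq> S"
proof -
  have "g q \<in> S" if "g \<in> generate (BijGroup Qpos3) {mu1, mu2, mu3}" "q \<in> S" for g q
    using that
  proof (induction g arbitrary: q rule: generate.induct)
    case one
    then show ?case using S by (auto simp: BijGroup_def)
  next
    case (incl h)
    then show ?case using closed by blast
  next
    case (inv h)
    then show ?case using closed inv_mu by simp
  next
    case (eng g h)
    then have "g \<in> Bij Qpos3" "h \<in> Bij Qpos3"
      using Gamma_hat_subset_Bij carrier_Gamma_hat by auto
    moreover have "q \<in> Qpos3"
      using eng.prems S by blast
    ultimately have "(g \<otimes>\<^bsub>BijGroup Qpos3\<^esub> h) q = g (h q)"
      by (simp add: BijGroup_def compose_def)
    then show ?case
      using eng by simp
  qed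
  then show ?thesis
    using p unfolding Gamma_orbit_def orbit_def carrier_Gamma_hat by blast
qed

section \<open>Mutations acting on integer solutions\<close>

lemma mu_of_int:
  assumes "is_pos_int_sol k x y z"
  shows "mu1 (of_int x, of_int y, of_int z) = (of_int (int k * y * z - x), of_int y, of_int z)"
    and "mu2 (of_int x, of_int y, of_int z) = (of_int x, of_int (int k * x * z - 2 * z - y), of_int z)"
    and "mu3 (of_int x, of_int y, of_int z) = (of_int x, of_int y, of_int (int k * x * y - 2 * y - z))"
proof -
  have pos: "0 < x" "0 < y" "0 < z"
    and eq: "x^2 + y^2 + z^2 + 2 * y * z = int k * x * y * z"
    using assms by (auto simp: is_pos_int_sol_def)
  \<comment> \<open>These are the products of the two roots of the quadratics in x, y and z.
    Dividing by the known root turns the fractions defining the mutations into sum of roots minus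
    known root, which is visibly an integer.\<close>
  have "(y + z)^2 = (int k * y * z - x) * x" "x^2 + z^2 = (int k * x * z - 2 * z - y) * y"
    "x^2 + y^2 = (int k * x * y - 2 * y - z) * z"
    using eq by (simp_all add: algebra_simps power2_eq_square)
  then have "(of_int ((y + z)^2) :: rat) = of_int ((int k * y * z - x) * x)"
    "(of_int (x^2 + z^2) :: rat) = of_int ((int k * x * z - 2 * z - y) * y)"
    "(of_int (x^2 + y^2) :: rat) = of_int ((int k * x * y - 2 * y - z) * z)"
    by simp_all
  with pos show
    "mu1 (of_int x, of_int y, of_int z) = (of_int (int k * y * z - x), of_int y, of_int z)"
    "mu2 (of_int x, of_int y, of_int z) = (of_int x, of_int (int k * x * z - 2 * z - y), of_int z)"
    "mu3 (of_int x, of_int y, of_int z) = (of_int x, of_int y, of_int (int k * x * y - 2 * y - z))"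
    by (simp_all add: mu1_def mu2_def mu3_def Qpos3_def)
qed

text \<open>Positivity of the new root: its product with the old, positive root is a positive square
  or sum of two squares.\<close>

lemma is_pos_int_sol_mutate:
  assumes "is_pos_int_sol k x y z"
  shows "is_pos_int_sol k (int k * y * z - x) y z"
    and "is_pos_int_sol k x (int k * x * z - 2 * z - y) z"
    and "is_pos_int_sol k x y (int k * x * y - 2 * y - z)"
proof -
  have pos: "0 < x" "0 < y" "0 < z"
    and eq: "x^2 + y^2 + z^2 + 2 * y * z = int k * x * y * z"
    using assms by (auto simp: is_pos_int_sol_def)
  have "x * (int k * y * z - x) = (y + z)^2" "y * (int k * x * z - 2 * z - y) = x^2 + z^2"
    "z * (int k * x * y - 2 * y - z) = x^2 + y^2"
    using eq by (simp_all add: algebra_simps power2_eq_square)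
  moreover have "0 < (y + z)^2" "0 < x^2 + z^2" "0 < x^2 + y^2"
    using pos by (simp_all add: sum_power2_gt_zero_iff)
  ultimately have "0 < int k * y * z - x" "0 < int k * x * z - 2 * z - y"
    "0 < int k * x * y - 2 * y - z"
    using pos by (metis zero_less_mult_pos)+
  with pos eq show "is_pos_int_sol k (int k * y * z - x) y z"
    "is_pos_int_sol k x (int k * x * z - 2 * z - y) z"
    "is_pos_int_sol k x y (int k * x * y - 2 * y - z)"
    by (simp_all add: is_pos_int_sol_def algebra_simps power2_eq_square)
qed

text \<open>Spreads an invariant \<open>P\<close> over a whole orbit. The constantly true
  \<open>P\<close> shows that mutation preserves solutions; the gcd and congruence invariants are
  further instances.\<close>

lemma Gamma_orbit_subset_sols:
  assumes sol: "is_pos_int_sol k a b c" and P: "P a b c"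
    and inv1: "\<And>x y z. P x y z \<Longrightarrow> P (int k * y * z - x) y z"
    and inv2: "\<And>x y z. P x y z \<Longrightarrow> P x (int k * x * z - 2 * z - y) z"
    and inv3: "\<And>x y z. P x y z \<Longrightarrow> P x y (int k * x * y - 2 * y - z)"
  shows "Gamma_orbit (of_int a, of_int b, of_int c) \<subseteq>
    {(of_int x, of_int y, of_int z) | x y z. is_pos_int_sol k x y z \<and> P x y z}" (is "_ \<subseteq> ?S")
proof (rule Gamma_orbit_subset)
  show "?S \<subseteq> Qpos3"
    by (auto simp: is_pos_int_sol_def Qpos3_def)
  show "(of_int a, of_int b, of_int c) \<in> ?S"
    using sol P by blast
next
  fix m q assume m: "m \<in> {mu1, mu2, mu3}" and "q \<in> ?S"
  then obtain x y z where q: "q = (of_int x, of_int y, of_int z)"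
    and s: "is_pos_int_sol k x y z" and p: "P x y z"
    by blast
  consider "m = mu1" | "m = mu2" | "m = mu3"
    using m by blast
  then show "m q \<in> ?S"
  proof cases
    case 1
    show ?thesis unfolding 1 q mu_of_int(1)[OF s] using is_pos_int_sol_mutate(1)[OF s] inv1[OF p] by blast
  next
    case 2
    show ?thesis unfolding 2 q mu_of_int(2)[OF s] using is_pos_int_sol_mutate(2)[OF s] inv2[OF p] by blast
  next
    case 3
    show ?thesis unfolding 3 q mu_of_int(3)[OF s] using is_pos_int_sol_mutate(3)[OF s] inv3[OF p] by blast
  qed
qed

section \<open>Descent to reduced solutions\<close>

definition reduced_sol :: "nat \<Rightarrow> int \<Rightarrow> int \<Rightarrow> int \<Rightarrow> bool" where
  "reduced_sol k x y z \<longleftrightarrow>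
     is_pos_int_sol k x y z \<and> x \<le> y + z \<and> y^2 \<le> x^2 + z^2 \<and> z^2 \<le> x^2 + y^2"

lemma mem_Qpos3_if_sol: "is_pos_int_sol k x y z \<Longrightarrow> (of_int x, of_int y, of_int z) \<in> Qpos3"
  by (simp add: is_pos_int_sol_def Qpos3_def)

text \<open>If one of the three inequalities of \<open>reduced_sol\<close> fails, the product of the
  roots is smaller than the square of the corresponding variable, so mutating that variable lowers
  the sum.\<close>

lemma sol_mem_orbit_of_reduced:
  assumes "is_pos_int_sol k x y z"
  shows "\<exists>a b c. reduced_sol k a b c \<and>
    (of_int x, of_int y, of_int z) \<in> Gamma_orbit (of_int a, of_int b, of_int c)"
  using assms
proof (induction "nat (x + y + z)" arbitrary: x y z rule: less_induct)
  case less
  note s = less.prems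
  have pos: "0 < x" "0 < y" "0 < z"
    and eq: "x^2 + y^2 + z^2 + 2 * y * z = int k * x * y * z"
    using s by (auto simp: is_pos_int_sol_def)
  \<comment> \<open>Shared by the three descent cases: the induction hypothesis applies to the
    mutated triple, and its orbit membership is pulled back through the involution.\<close>
  have step: ?case
    if st: "m \<in> {mu1, mu2, mu3}" "m (of_int x, of_int y, of_int z) = (of_int x', of_int y', of_int z')"
      "is_pos_int_sol k x' y' z'" "x' + y' + z' < x + y + z" for m x' y' z'
  proof -
    have "nat (x' + y' + z') < nat (x + y + z)"
      using st(4) pos by simp
    from less.hyps[OF this st(3)] obtain a b c where r: "reduced_sol k a b c"
      and "m (of_int x, of_int y, of_int z) \<in> Gamma_orbit (of_int a, of_int b, of_int c)"
      using st(2) by auto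
    with mem_Gamma_orbit_if_mu_mem[OF st(1)] mem_Qpos3_if_sol s show ?thesis
      unfolding reduced_sol_def by blast
  qed
  consider "y + z < x" | "x^2 + z^2 < y^2" | "x^2 + y^2 < z^2" | "reduced_sol k x y z"
    using s unfolding reduced_sol_def by linarith
  then show ?case
  proof cases
    case 1
    then have "(y + z)^2 < x^2"
      using pos by (intro power_strict_mono) auto
    moreover have "x * (int k * y * z - x) = (y + z)^2"
      using eq by (simp add: algebra_simps power2_eq_square)
    ultimately have "x * (int k * y * z - x) < x * x"
      by (simp add: power2_eq_square)
    then have "int k * y * z - x < x"
      using pos by (simp only: mult_less_cancel_left_pos)
    then show ?thesis
      using step[of mu1, OF _ mu_of_int(1)[OF s] is_pos_int_sol_mutate(1)[OF s]] by simp
  next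
    case 2
    moreover have "y * (int k * x * z - 2 * z - y) = x^2 + z^2"
      using eq by (simp add: algebra_simps power2_eq_square)
    ultimately have "y * (int k * x * z - 2 * z - y) < y * y"
      by (simp add: power2_eq_square)
    then have "int k * x * z - 2 * z - y < y"
      using pos by (simp only: mult_less_cancel_left_pos)
    then show ?thesis
      using step[of mu2, OF _ mu_of_int(2)[OF s] is_pos_int_sol_mutate(2)[OF s]] by simp
  next
    case 3
    moreover have "z * (int k * x * y - 2 * y - z) = x^2 + y^2"
      using eq by (simp add: algebra_simps power2_eq_square)
    ultimately have "z * (int k * x * y - 2 * y - z) < z * z"
      by (simp add: power2_eq_square)
    then have "int k * x * y - 2 * y - z < z"
      using pos by (simp only: mult_less_cancel_left_pos)
    then show ?thesis
      using step[of mu3, OF _ mu_of_int(3)[OF s] is_pos_int_sol_mutate(3)[OF s]] by simp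
  next
    case 4
    then show ?thesis
      using mem_Gamma_orbit_self[OF mem_Qpos3_if_sol[OF s]] by blast
  qed
qed

section \<open>Classification of reduced solutions\<close>

lemma mult_le_5_cases:
  fixes s t :: int
  assumes "0 < s" "0 < t" "s * t \<le> 5"
  shows "(s, t) \<in> {(1, 1), (1, 2), (1, 3), (1, 4), (1, 5), (2, 1), (2, 2), (3, 1), (4, 1), (5, 1)}"
proof -
  have "s * 1 \<le> s * t" "1 * t \<le> s * t"
    using assms by (auto intro: mult_left_mono mult_right_mono)
  then have "s \<le> 5" "t \<le> 5"
    using assms by linarith+
  then have "s \<in> {1, 2, 3, 4, 5}" "t \<in> {1, 2, 3, 4, 5}"
    using assms by auto
  then show ?thesis
    using assms(3) by (elim insertE emptyE; simp)
qed

text \<open>The candidates with x largest and z <= y, where K * z <= 5, y <= 3 * z and x <= y +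
  z.\<close>

lemma finite_check_x_max:
  "\<forall>(K, z)\<in>{(1, 1), (1, 2), (1, 3), (1, 4), (1, 5), (2, 1), (2, 2), (3, 1), (4, 1), (5, 1)}.
    \<forall>y\<in>set [z..3 * z]. \<forall>x\<in>set [y..y + z].
      x * x + (y + z) * (y + z) = K * x * y * z \<longrightarrow>
      (K, x, y, z) \<in> {(1, 9, 6, 3), (1, 8, 4, 4), (1, 5, 5, 5), (2, 4, 2, 2), (3, 3, 2, 1),
        (4, 2, 1, 1), (5, 1, 1, 1)}"
  \<comment> \<open>Without \<open>set_upto\<close> the intervals unfold into explicit lists. The
    extra rule unfolds those starting at 1, which is not of the form
    \<open>numeral n\<close>.\<close>
  by (simp del: set_upto add: upto_rec1[of 1 "numeral n" for n])

text \<open>The two orders with y strictly largest, after K = 1 has been forced: the smallest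
  variable is between 3 and 5, the middle one at most 12, and y < x + z. Nothing survives.\<close>

lemma finite_check_y_max:
  "\<forall>z\<in>set [3..5]. \<forall>x\<in>set [z..12]. \<forall>y\<in>set [x + 1..x + z - 1].
     x * x + (y + z) * (y + z) \<noteq> x * y * (z :: int)"
  "\<forall>x\<in>set [3..5]. \<forall>z\<in>set [x..12]. \<forall>y\<in>set [z + 1..z + x - 1].
     x * x + (y + z) * (y + z) \<noteq> x * y * (z :: int)"
  by (simp_all del: set_upto)

text \<open>With z <= y, three orders remain according to the position of x. All solutions come from
  the order with x largest.\<close>

lemma reduced_sol_ordered:
  assumes red: "reduced_sol k x y z" and "z \<le> y"
  shows "(int k, x, y, z) \<in> {(1, 9, 6, 3), (1, 8, 4, 4), (1, 5, 5, 5), (2, 4, 2, 2), (3, 3, 2, 1),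
    (4, 2, 1, 1), (5, 1, 1, 1)}"
proof -
  define K where "K = int k"
  have pos: "0 < x" "0 < y" "0 < z" and xyz: "x \<le> y + z" and y2: "y^2 \<le> x^2 + z^2"
    and eq: "x^2 + y^2 + z^2 + 2 * y * z = K * x * y * z"
    using red by (auto simp: reduced_sol_def is_pos_int_sol_def K_def)
  have "0 < x^2 + y^2 + z^2 + 2 * y * z"
    using pos by (intro add_pos_pos) auto
  then have "K \<noteq> 0"
    using eq by auto
  then have K: "1 \<le> K"
    by (simp add: K_def)
  have eq': "x * x + (y + z) * (y + z) = K * x * y * z"
    using eq by (simp add: algebra_simps power2_eq_square)
  have le_5: "t \<le> 5" if "K * t \<le> 5" "0 < t" for t
    using mult_le_5_cases[of K t] K that by auto
  have K_eq_1: "K = 1" if "K * t \<le> 5" "3 \<le> t" for t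
  proof -
    have "K * 3 \<le> K * t"
      using that(2) K by (intro mult_left_mono) auto
    then show ?thesis
      using that(1) K by linarith
  qed
  have sq_le: "s * t \<le> t^2" if "s \<le> t" "0 < t" for s t :: int
    using that by (simp add: power2_eq_square)
  have cancel: "K * s \<le> 5" if "K * s * t^2 \<le> 5 * t^2" "0 < t" for s t
    using that by simp
  have y'_ge: "y \<le> K * x * z - 2 * z - y"
  proof -
    have "y * (K * x * z - 2 * z - y) = x^2 + z^2"
      using eq by (simp add: algebra_simps power2_eq_square)
    then have "y * y \<le> y * (K * x * z - 2 * z - y)"
      using y2 by (simp add: power2_eq_square)
    then show ?thesis
      using pos by simp
  qed
  have y_less: "y < x + z"
  proof (rule power2_less_imp_less)
    have "0 < x * z"
      using pos by simp
    then show "y^2 < (x + z)^2"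
      using y2 by (simp add: power2_sum)
  qed (use pos in simp)
  consider "y \<le> x" | "x < y" "z \<le> x" | "x < y" "x \<le> z"
    by linarith
  then have "(K, x, y, z) \<in> {(1, 9, 6, 3), (1, 8, 4, 4), (1, 5, 5, 5), (2, 4, 2, 2), (3, 3, 2, 1),
    (4, 2, 1, 1), (5, 1, 1, 1)}"
  proof cases
    case 1
    have "x * (K * y * z - x) = (y + z)^2"
      using eq by (simp add: algebra_simps power2_eq_square)
    moreover have "x * x \<le> (y + z)^2"
      using xyz pos by (simp add: power2_eq_square mult_mono)
    ultimately have "x * x \<le> x * (K * y * z - x)"
      by simp
    then have x'_ge: "x \<le> K * y * z - x"
      using pos by simp
    \<comment> \<open>The right side is the quadratic in x evaluated at y, which is nonnegative
      because y lies below both roots.\<close>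
    have "0 \<le> (x - y) * ((K * y * z - x) - y)"
      using 1 x'_ge by simp
    then have *: "K * z * y^2 \<le> y^2 + (y + z)^2"
      using eq by (simp add: algebra_simps power2_eq_square)
    moreover have "(y + z)^2 \<le> 4 * y^2"
      using power_mono[of "y + z" "2 * y" 2] \<open>z \<le> y\<close> pos by (simp add: power_mult_distrib)
    ultimately have Kz: "K * z \<le> 5"
      using pos by (intro cancel[of z y]) linarith+
    \<comment> \<open>Otherwise y + z < 4 * y / 3, so \<open>*\<close> gives K * z < 1 + 16/9 < 3.
      But K * z <= 2 contradicts the inequality x^2 + (y + z)^2 >= 2 * x * (y + z) > 2 * x *
      y.\<close>
    have "y \<le> 3 * z"
    proof (rule ccontr)
      assume "\<not> y \<le> 3 * z"
      then have "(3 * (y + z))^2 < (4 * y)^2"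
        using pos by (intro power_strict_mono) auto
      then have "9 * (y + z)^2 < 16 * y^2"
        unfolding power_mult_distrib by simp
      moreover have "0 < y^2"
        using pos by simp
      ultimately have "K * z * y^2 < 3 * y^2"
        using * by linarith
      then have "K * z < 3"
        using pos by simp
      have "x * x + (y + z) * (y + z) = (K * z) * (x * y)"
        using eq by (simp add: algebra_simps power2_eq_square)
      also have "\<dots> \<le> 2 * (x * y)"
        using \<open>K * z < 3\<close> pos by (intro mult_right_mono) auto
      also have "\<dots> < 2 * (x * (y + z))"
        using pos by simp
      also have "\<dots> \<le> x * x + (y + z) * (y + z)"
        using zero_le_square[of "x - (y + z)"] by (simp add: algebra_simps)
      finally show False
        by simp
    qed
    then have y: "y \<in> set [z..3 * z]" and x: "x \<in> set [y..y + z]"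
      using 1 \<open>z \<le> y\<close> xyz by auto
    have "0 < K"
      using K by simp
    note check = bspec[OF finite_check_x_max mult_le_5_cases[OF this pos(3) Kz], unfolded prod.case]
    from mp[OF bspec[OF bspec[OF check y] x] eq'] show ?thesis .
  next
    case 2
    \<comment> \<open>Now y is largest, and its quadratic is evaluated at the second largest
      variable x.\<close>
    have "0 \<le> (y - x) * ((K * x * z - 2 * z - y) - x)"
      using 2 y'_ge by simp
    then have "K * z * x^2 \<le> 2 * x^2 + 2 * (z * x) + z^2"
      using eq by (simp add: algebra_simps power2_eq_square)
    moreover have "z^2 \<le> z * x"
      using 2 pos by (simp add: power2_eq_square)
    ultimately have Kz: "K * z \<le> 5"
      using sq_le[of z x] 2 pos by (intro cancel[of z x]) linarith+
    \<comment> \<open>Since x < y, reducedness gives 2 * x + 1 <= z^2. With z <= 5 this bounds x by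
      12, and with z <= x it excludes z <= 2.\<close>
    have "(x + 1)^2 \<le> y^2" "z^2 \<le> 5^2"
      using 2 pos le_5[OF Kz] by (intro power_mono; simp)+
    then have "x \<le> 12"
      using y2 by (simp add: power2_sum)
    have "3 \<le> z"
    proof (rule ccontr)
      assume "\<not> 3 \<le> z"
      then have "z^2 \<le> 2 * z"
        using pos by (simp add: power2_eq_square)
      with \<open>(x + 1)^2 \<le> y^2\<close> y2 2 show False
        by (simp add: power2_sum)
    qed
    with Kz have "K = 1"
      by (rule K_eq_1)
    have "z \<in> set [3..5]" "x \<in> set [z..12]" "y \<in> set [x + 1..x + z - 1]"
      using \<open>3 \<le> z\<close> le_5[OF Kz] \<open>x \<le> 12\<close> 2 y_less by auto
    from bspec[OF bspec[OF bspec[OF finite_check_y_max(1) this(1)] this(2)] this(3)] show ?thesis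
      using eq' \<open>K = 1\<close> by simp
  next
    case 3
    \<comment> \<open>The same evaluation, with z as second largest variable.\<close>
    have "0 \<le> (y - z) * ((K * x * z - 2 * z - y) - z)"
      using \<open>z \<le> y\<close> y'_ge by simp
    then have "K * x * z^2 \<le> 4 * z^2 + x^2"
      using eq by (simp add: algebra_simps power2_eq_square)
    moreover have "x^2 \<le> z^2"
      using 3 pos by (intro power_mono) auto
    ultimately have Kx: "K * x \<le> 5"
      using pos by (intro cancel[of x z]) linarith+
    \<comment> \<open>Equality would make (x / z)^2 the integer K * x - 4, although 0 < x < z.
      Strictness is what yields 2 * z + 1 <= x^2 below.\<close>
    have "y \<noteq> z"
    proof
      assume "y = z"
      then have "x * x = z * (z * (K * x - 4))"
        using eq by (simp add: algebra_simps power2_eq_square)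
      moreover have "x * x < z * z"
        using 3 \<open>y = z\<close> pos by (simp add: mult_strict_mono)
      moreover have "0 < x * x"
        using pos by simp
      ultimately have "z * (z * (K * x - 4)) < z * (z * 1)" "0 < z * (z * (K * x - 4))"
        by simp_all
      then have "K * x - 4 < 1" "0 < K * x - 4"
        using pos by (simp_all only: mult_less_cancel_left_pos zero_less_mult_iff, auto)
      then show False
        by simp
    qed
    with \<open>z \<le> y\<close> have "(z + 1)^2 \<le> y^2" "x^2 \<le> 5^2"
      using \<open>z \<le> y\<close> pos le_5[OF Kx] by (intro power_mono; simp)+
    then have "z \<le> 12"
      using y2 by (simp add: power2_sum)
    have "3 \<le> x"
    proof (rule ccontr)
      assume "\<not> 3 \<le> x"
      then have "x^2 \<le> 2 * x"
        using pos by (simp add: power2_eq_square)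
      with \<open>(z + 1)^2 \<le> y^2\<close> y2 3 show False
        by (simp add: power2_sum)
    qed
    with Kx have "K = 1"
      by (rule K_eq_1)
    have "x \<in> set [3..5]" "z \<in> set [x..12]" "y \<in> set [z + 1..z + x - 1]"
      using \<open>3 \<le> x\<close> le_5[OF Kx] \<open>z \<le> 12\<close> 3 \<open>z \<le> y\<close> \<open>y \<noteq> z\<close> y_less by auto
    from bspec[OF bspec[OF bspec[OF finite_check_y_max(2) this(1)] this(2)] this(3)] show ?thesis
      using eq' \<open>K = 1\<close> by simp
  qed
  then show ?thesis
    by (simp add: K_def)
qed

lemma reduced_sol_cases:
  assumes "reduced_sol k x y z"
  shows "(k, x, y, z) \<in> {(1, 9, 3, 6), (1, 9, 6, 3), (1, 8, 4, 4), (1, 5, 5, 5), (2, 4, 2, 2),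
    (3, 3, 2, 1), (3, 3, 1, 2), (4, 2, 1, 1), (5, 1, 1, 1)}"
proof (cases "z \<le> y")
  case True
  from reduced_sol_ordered[OF assms this] show ?thesis
    by auto
next
  case False
  have "reduced_sol k x z y"
    using assms by (auto simp: reduced_sol_def is_pos_int_sol_def algebra_simps)
  from reduced_sol_ordered[OF this] False show ?thesis
    by auto
qed

section \<open>Solution sets as unions of orbits\<close>

lemma Gamma_orbit_subset_pos_int_sols:
  assumes "is_pos_int_sol k a b c"
  shows "Gamma_orbit (of_int a, of_int b, of_int c) \<subseteq> pos_int_sols k"
  using Gamma_orbit_subset_sols[of k a b c "\<lambda>_ _ _. True"] assms
  by (auto simp: pos_int_sols_def)

text \<open>Descent gives one inclusion and closure under mutation the other. Whether different
  reduced solutions share an orbit is left to the invariants.\<close>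

lemma pos_int_sols_eq:
  "pos_int_sols k = (\<Union>(a, b, c) \<in> {(a, b, c). reduced_sol k a b c}.
     Gamma_orbit (of_int a, of_int b, of_int c))"
proof
  show "pos_int_sols k \<subseteq> (\<Union>(a, b, c) \<in> {(a, b, c). reduced_sol k a b c}.
      Gamma_orbit (of_int a, of_int b, of_int c))"
    unfolding pos_int_sols_def using sol_mem_orbit_of_reduced by fastforce
  show "(\<Union>(a, b, c) \<in> {(a, b, c). reduced_sol k a b c}.
      Gamma_orbit (of_int a, of_int b, of_int c)) \<subseteq> pos_int_sols k"
    using Gamma_orbit_subset_pos_int_sols unfolding reduced_sol_def by blast
qed

section \<open>Invariants separating the orbits\<close>

lemma gcd3_mutate:
  fixes x y z K :: int
  shows "gcd (K * y * z - x) (gcd y z) = gcd x (gcd y z)"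
    and "gcd x (gcd (K * x * z - 2 * z - y) z) = gcd x (gcd y z)"
    and "gcd x (gcd y (K * x * y - 2 * y - z)) = gcd x (gcd y z)"
proof -
  \<comment> \<open>Each mutation replaces a variable u by c - u, where c is a multiple of
    \<open>gcd y z\<close>, z or y when u is x, y or z respectively.\<close>
  have diff: "gcd (c - u) d = gcd u d" if "d dvd c" for c u d :: int
  proof -
    obtain e where "c = d * e"
      using \<open>d dvd c\<close> ..
    then show ?thesis
      using gcd_add_mult[of d e "- u"] by (simp add: gcd.commute algebra_simps)
  qed
  show "gcd (K * y * z - x) (gcd y z) = gcd x (gcd y z)"
    by (rule diff) simp
  have "gcd (K * x * z - 2 * z - y) z = gcd y z" "gcd (K * x * y - 2 * y - z) y = gcd z y"
    by (rule diff; simp)+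
  then show "gcd x (gcd (K * x * z - 2 * z - y) z) = gcd x (gcd y z)"
    "gcd x (gcd y (K * x * y - 2 * y - z)) = gcd x (gcd y z)"
    by (simp_all add: gcd.commute)
qed

lemma gcd_const_on_Gamma_orbit:
  assumes "is_pos_int_sol k a b c"
    and "(of_int x, of_int y, of_int z) \<in> Gamma_orbit (of_int a, of_int b, of_int c)"
  shows "gcd x (gcd y z) = gcd a (gcd b c)"
  using Gamma_orbit_subset_sols[OF assms(1), of "\<lambda>x y z. gcd x (gcd y z) = gcd a (gcd b c)"]
    assms(2) by (auto simp: gcd3_mutate)

text \<open>
  The mutation of \<open>y\<close> sends \<open>y - b\<close> to \<open>k x z - 2 (z - c) - (y - b) - 2 (b + c)\<close>, a multiple of
  \<open>3 d\<close>; the one of \<open>z\<close> is symmetric.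
\<close>

lemma cong_const_on_Gamma_orbit:
  fixes d :: int
  assumes sol: "is_pos_int_sol k a b c" and k: "3 dvd int k * d"
    and d: "d dvd a" "d dvd b" "d dvd c" and bc: "3 * d dvd b + c"
    and mem: "(of_int x, of_int y, of_int z) \<in> Gamma_orbit (of_int a, of_int b, of_int c)"
  shows "3 * d dvd y - b"
proof -
  \<comment> \<open>Divisibility by d is carried along so that k * u * v stays a multiple of 3 * d:
    one factor d combines with k to give the 3, the other remains.\<close>
  define P where "P x y z \<longleftrightarrow> d dvd x \<and> d dvd y \<and> d dvd z \<and> 3 * d dvd y - b \<and> 3 * d dvd z - c"
    for x y z
  have kd: "3 * d dvd int k * u * v" if "d dvd u" "d dvd v" for u v
  proof -
    obtain e where "int k * d = 3 * e"
      using k ..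
    moreover obtain u' where "u = d * u'"
      using \<open>d dvd u\<close> ..
    moreover obtain v' where "v = d * v'"
      using \<open>d dvd v\<close> ..
    ultimately have "int k * u * v = 3 * d * (e * u' * v')"
      by (simp add: mult_ac)
    then show ?thesis
      by (rule dvdI)
  qed
  have "Gamma_orbit (of_int a, of_int b, of_int c) \<subseteq>
    {(of_int x, of_int y, of_int z) | x y z. is_pos_int_sol k x y z \<and> P x y z}"
  proof (rule Gamma_orbit_subset_sols)
    show "P a b c"
      using d by (simp add: P_def)
    fix x y z assume P: "P x y z"
    then show "P (int k * y * z - x) y z"
      by (simp add: P_def)
    have yb: "3 * d dvd y - b" and zc: "3 * d dvd z - c" and "d dvd x" "d dvd y" "d dvd z"
      using P by (simp_all add: P_def)
    then have "3 * d dvd int k * x * z - 2 * (z - c) - (y - b) - 2 * (b + c)"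
      "3 * d dvd int k * x * y - 2 * (y - b) - (z - c) - 2 * (b + c)"
      using dvd_diff[OF dvd_diff[OF dvd_diff[OF kd dvd_mult[OF zc]] yb] dvd_mult[OF bc]]
        dvd_diff[OF dvd_diff[OF dvd_diff[OF kd dvd_mult[OF yb]] zc] dvd_mult[OF bc]]
      by blast+
    then have "3 * d dvd int k * x * z - 2 * z - y - b" "3 * d dvd int k * x * y - 2 * y - z - c"
      by (simp_all add: algebra_simps)
    then show "P x (int k * x * z - 2 * z - y) z" "P x y (int k * x * y - 2 * y - z)"
      using P by (auto simp: P_def)
  qed (rule sol)
  then show ?thesis
    using mem by (auto simp: P_def)
qed

lemma Gamma_orbits_disjoint_if_gcd_neq:
  assumes p: "is_pos_int_sol k a b c" and q: "is_pos_int_sol k a' b' c'"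
    and "gcd a (gcd b c) \<noteq> gcd a' (gcd b' c')"
  shows "Gamma_orbit (of_int a, of_int b, of_int c) \<inter>
    Gamma_orbit (of_int a', of_int b', of_int c') = {}"
proof (rule equals0I)
  fix r
  assume r: "r \<in> Gamma_orbit (of_int a, of_int b, of_int c) \<inter>
    Gamma_orbit (of_int a', of_int b', of_int c')"
  then obtain x y z where "r = (of_int x, of_int y, of_int z)"
    using Gamma_orbit_subset_pos_int_sols[OF p] by (auto simp: pos_int_sols_def)
  then show False
    using r gcd_const_on_Gamma_orbit[OF p, of x y z] gcd_const_on_Gamma_orbit[OF q, of x y z]
      assms(3) by simp
qed

text \<open>A common point would have its middle entry congruent to both b and c modulo 3 * d. The
  modulus is 9 (d = 3) for (9, 3, 6) with k = 1, and 3 (d = 1) for (3, 2, 1) with k = 3.\<close>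

lemma Gamma_orbits_disjoint_if_not_cong:
  fixes d :: int
  assumes p: "is_pos_int_sol k a b c" and q: "is_pos_int_sol k a c b"
    and k: "3 dvd int k * d" and d: "d dvd a" "d dvd b" "d dvd c" and bc: "3 * d dvd b + c"
    and "\<not> 3 * d dvd b - c"
  shows "Gamma_orbit (of_int a, of_int b, of_int c) \<inter>
    Gamma_orbit (of_int a, of_int c, of_int b) = {}"
proof (rule equals0I)
  fix r
  assume r: "r \<in> Gamma_orbit (of_int a, of_int b, of_int c) \<inter>
    Gamma_orbit (of_int a, of_int c, of_int b)"
  then obtain x y z where xyz: "r = (of_int x, of_int y, of_int z)"
    using Gamma_orbit_subset_pos_int_sols[OF p] by (auto simp: pos_int_sols_def)
  have "3 * d dvd y - b" "3 * d dvd y - c"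
    using r cong_const_on_Gamma_orbit[OF p k d bc, of x y z]
      cong_const_on_Gamma_orbit[OF q k d(1,3,2), of x y z] bc
    by (simp_all add: xyz add.commute)
  from dvd_diff[OF this(2,1)] show False
    using assms(8) by simp
qed

section \<open>Representatives and the final orbit count\<close>

lemma reduced_sol_iff:
  "reduced_sol k x y z \<longleftrightarrow>
    (k, x, y, z) \<in> {(1, 9, 3, 6), (1, 9, 6, 3), (1, 8, 4, 4), (1, 5, 5, 5), (2, 4, 2, 2),
      (3, 3, 2, 1), (3, 3, 1, 2), (4, 2, 1, 1), (5, 1, 1, 1)}"
proof
  assume "(k, x, y, z) \<in> {(1, 9, 3, 6), (1, 9, 6, 3), (1, 8, 4, 4), (1, 5, 5, 5), (2, 4, 2, 2),
    (3, 3, 2, 1), (3, 3, 1, 2), (4, 2, 1, 1), (5, 1, 1, 1)}"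
  then show "reduced_sol k x y z"
    by (elim insertE emptyE) (simp_all add: reduced_sol_def is_pos_int_sol_def)
qed (rule reduced_sol_cases)

theorem theorem1p3:
  shows "(\<forall>k::nat. (\<exists>x y z. is_pos_int_sol k x y z) \<longleftrightarrow> 1 \<le> k \<and> k \<le> 5)
    \<and> (let Orbs = {Gamma_orbit (9, 3, 6), Gamma_orbit (9, 6, 3),
                   Gamma_orbit (8, 4, 4), Gamma_orbit (5, 5, 5)}
       in partition_on (pos_int_sols 1) Orbs \<and> card Orbs = 4)
    \<and> (let Orbs = {Gamma_orbit (3, 2, 1), Gamma_orbit (3, 1, 2)}
       in partition_on (pos_int_sols 3) Orbs \<and> card Orbs = 2)
    \<and> pos_int_sols 2 = Gamma_orbit (4, 2, 2)
    \<and> pos_int_sols 4 = Gamma_orbit (2, 1, 1)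
    \<and> pos_int_sols 5 = Gamma_orbit (1, 1, 1)"
proof -
  have solvable: "(\<exists>x y z. is_pos_int_sol k x y z) \<longleftrightarrow> 1 \<le> k \<and> k \<le> 5" for k
  proof
    assume "\<exists>x y z. is_pos_int_sol k x y z"
    then obtain a b c where "reduced_sol k a b c"
      using sol_mem_orbit_of_reduced by blast
    then show "1 \<le> k \<and> k \<le> 5"
      by (auto simp: reduced_sol_iff)
  next
    assume "1 \<le> k \<and> k \<le> 5"
    then consider "k = 1" | "k = 2" | "k = 3" | "k = 4" | "k = 5"
      by linarith
    then have "\<exists>x y z. reduced_sol k x y z"
      by cases (auto simp: reduced_sol_iff)
    then show "\<exists>x y z. is_pos_int_sol k x y z"
      by (auto simp: reduced_sol_def)
  qed
  have reduced_1: "{(a, b, c). reduced_sol 1 a b c} = {(9, 3, 6), (9, 6, 3), (8, 4, 4), (5, 5, 5)}"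
    and reduced_2: "{(a, b, c). reduced_sol 2 a b c} = {(4, 2, 2)}"
    and reduced_3: "{(a, b, c). reduced_sol 3 a b c} = {(3, 2, 1), (3, 1, 2)}"
    and reduced_4: "{(a, b, c). reduced_sol 4 a b c} = {(2, 1, 1)}"
    and reduced_5: "{(a, b, c). reduced_sol 5 a b c} = {(1, 1, 1)}"
    by (auto simp: reduced_sol_iff)
  have nonempty: "Gamma_orbit (x, y, z) \<noteq> {}" if "0 < x" "0 < y" "0 < z" for x y z
    using mem_Gamma_orbit_self[of "(x, y, z)"] that by (auto simp: Qpos3_def)
  have sols_1: "is_pos_int_sol 1 9 3 6" "is_pos_int_sol 1 9 6 3" "is_pos_int_sol 1 8 4 4"
    "is_pos_int_sol 1 5 5 5"
    and sols_3: "is_pos_int_sol 3 3 2 1" "is_pos_int_sol 3 3 1 2"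
    by (simp_all add: is_pos_int_sol_def)
  note disjoint_gcd = Gamma_orbits_disjoint_if_gcd_neq[of 1]
  \<comment> \<open>The gcds of the representatives are 3, 3, 4 and 5, so only the first pair relies
    on the congruence.\<close>
  have disjoint_1:
    "Gamma_orbit (9, 3, 6) \<inter> Gamma_orbit (9, 6, 3) = {}"
    "Gamma_orbit (9, 3, 6) \<inter> Gamma_orbit (8, 4, 4) = {}"
    "Gamma_orbit (9, 3, 6) \<inter> Gamma_orbit (5, 5, 5) = {}"
    "Gamma_orbit (9, 6, 3) \<inter> Gamma_orbit (8, 4, 4) = {}"
    "Gamma_orbit (9, 6, 3) \<inter> Gamma_orbit (5, 5, 5) = {}"
    "Gamma_orbit (8, 4, 4) \<inter> Gamma_orbit (5, 5, 5) = {}"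
    using Gamma_orbits_disjoint_if_not_cong[OF sols_1(1,2), of 3]
      disjoint_gcd[OF sols_1(1,3)] disjoint_gcd[OF sols_1(1,4)] disjoint_gcd[OF sols_1(2,3)]
      disjoint_gcd[OF sols_1(2,4)] disjoint_gcd[OF sols_1(3,4)]
    by (simp_all add: gcd_non_0_int)
  have disjoint_3: "Gamma_orbit (3, 2, 1) \<inter> Gamma_orbit (3, 1, 2) = {}"
    using Gamma_orbits_disjoint_if_not_cong[OF sols_3, of 1] by simp
  \<comment> \<open>At most one of the sets can be empty, so disjointness makes them pairwise
    distinct and the cardinality is 4.\<close>
  have pairwise: "disjoint {A, B, C, D} \<and> card {A, B, C, D} = 4"
    if "A \<inter> B = {}" "A \<inter> C = {}" "A \<inter> D = {}" "B \<inter> C = {}" "B \<inter> D = {}" "C \<inter> D = {}"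
      and "A \<noteq> {}" "B \<noteq> {}" "C \<noteq> {}" for A B C D :: "(rat \<times> rat \<times> rat) set"
  proof -
    have "A \<noteq> B" "A \<noteq> C" "A \<noteq> D" "B \<noteq> C" "B \<noteq> D" "C \<noteq> D"
      using that by blast+
    then show ?thesis
      using that by (simp add: disjoint_def Int_commute)
  qed
  have "partition_on (pos_int_sols 1) Orbs \<and> card Orbs = 4"
    if "Orbs = {Gamma_orbit (9, 3, 6), Gamma_orbit (9, 6, 3), Gamma_orbit (8, 4, 4),
      Gamma_orbit (5, 5, 5)}" for Orbs
  proof -
    have "\<Union>Orbs = pos_int_sols 1"
      unfolding that pos_int_sols_eq reduced_1 by simp
    moreover have "disjoint Orbs \<and> card Orbs = 4"
      unfolding that by (intro pairwise disjoint_1 nonempty) simp_all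
    moreover have "{} \<notin> Orbs"
      unfolding that using nonempty[symmetric] by simp
    ultimately show ?thesis
      by (simp add: partition_on_def)
  qed
  moreover have "partition_on (pos_int_sols 3) Orbs \<and> card Orbs = 2"
    if "Orbs = {Gamma_orbit (3, 2, 1), Gamma_orbit (3, 1, 2)}" for Orbs
  proof -
    have "\<Union>Orbs = pos_int_sols 3"
      unfolding that pos_int_sols_eq reduced_3 by simp
    moreover have "{} \<notin> Orbs"
      unfolding that using nonempty[symmetric] by simp
    moreover have "Gamma_orbit (3, 2, 1) \<noteq> Gamma_orbit (3, 1, 2)"
      using disjoint_3 nonempty by force
    ultimately show ?thesis
      using disjoint_3 by (simp add: that partition_on_def disjoint_def Int_commute)
  qed
  moreover have "pos_int_sols 2 = Gamma_orbit (4, 2, 2)" "pos_int_sols 4 = Gamma_orbit (2, 1, 1)"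
    "pos_int_sols 5 = Gamma_orbit (1, 1, 1)"
    by (simp_all add: pos_int_sols_eq reduced_2 reduced_4 reduced_5)
  ultimately show ?thesis
    using solvable unfolding Let_def by (intro conjI allI) simp_all
qed

end
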